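(* There exists a constant $D\ge 1$ such that for every integer $n\ge 2$ there is a map $f:C_2\wr C_n\to L_1$ and a scaling factor $\lambda>0$ with $$\lambda\,\rho(u,v)\le \|f(u)-f(v)\|_1\le D\,\lambda\,\rho(u,v)\qquad\text{for all } u,v\in C_2\wr C_n,$$ where $\rho$ is the word metric on $C_2\wr C_n$; i.e. the cyclic lamplighter groups $C_2\wr C_n$ embed bi-Lipschitzly into $L_1$ with distortion bounded independently of $n$.
   Context: $C_n$ denotes the cyclic group of order $n$, and $L_1=L_1([0,1])$. $C_2\wr C_n$ is the group of all pairs $(x,j)$ with $x:C_n\to C_2$ and $j\in C_n$, with product $(x,i)(y,j)=(k\mapsto x(k)+y(k-i),\,i+j)$ (additive notation). $\rho$ is the left-invariant word metric induced by the canonical generators $(0,\pm1)$ (moving one step on the cycle) and $(\delta_0,0)$ (switching the lamp at the current position), where $\delta_0:C_n\to C_2$ is the indicator function of $0\in C_n$. *)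

theory Defs
  imports "HOL-Analysis.Analysis" "HOL-Algebra.Elementary_Groups" "HOL-Algebra.Generated_Groups"
begin

section \<open>Word metrics\<close>

definition is_word :: "('a, 'b) monoid_scheme \<Rightarrow> 'a set \<Rightarrow> 'a list \<Rightarrow> bool" where
  "is_word G S ws \<longleftrightarrow> set ws \<subseteq> S \<union> m_inv G ` S"

definition word_value :: "('a, 'b) monoid_scheme \<Rightarrow> 'a list \<Rightarrow> 'a" where
  "word_value G ws = foldr (monoid.mult G) ws \<one>\<^bsub>G\<^esub>"

text \<open>
  The minimum is only meaningful if \<open>S\<close> generates \<open>G\<close>; see \<open>generate_imp_word\<close> and
  \<open>generate_lamplighter\<close> below.
\<close>
definition word_length :: "('a, 'b) monoid_scheme \<Rightarrow> 'a set \<Rightarrow> 'a \<Rightarrow> nat" where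
  "word_length G S g =
     (LEAST k. \<exists>ws. is_word G S ws \<and> word_value G ws = g \<and> length ws = k)"

definition word_metric :: "('a, 'b) monoid_scheme \<Rightarrow> 'a set \<Rightarrow> 'a \<Rightarrow> 'a \<Rightarrow> real" where
  "word_metric G S u v = real (word_length G S (inv\<^bsub>G\<^esub> u \<otimes>\<^bsub>G\<^esub> v))"

section \<open>The cyclic lamplighter group\<close>

abbreviation cyc :: "nat \<Rightarrow> int monoid" where
  "cyc n \<equiv> integer_mod_group n"

text \<open>
  Lamp configurations are the functions on \<open>carrier (cyc n)\<close>, made extensional so that
  equality in the carrier is equality of functions on the cycle.
\<close>
definition lamplighter :: "nat \<Rightarrow> ((int \<Rightarrow> int) \<times> int) monoid" where
  "lamplighter n =
    \<lparr>carrier = (carrier (cyc n) \<rightarrow>\<^sub>E carrier (cyc 2)) \<times> carrier (cyc n),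
     monoid.mult = (\<lambda>(x, i) (y, j).
       (\<lambda>k\<in>carrier (cyc n). x k \<otimes>\<^bsub>cyc 2\<^esub> y (k \<otimes>\<^bsub>cyc n\<^esub> inv\<^bsub>cyc n\<^esub> i),
        i \<otimes>\<^bsub>cyc n\<^esub> j)),
     one = (\<lambda>k\<in>carrier (cyc n). \<one>\<^bsub>cyc 2\<^esub>, \<one>\<^bsub>cyc n\<^esub>)\<rparr>"

definition no_lamp :: "nat \<Rightarrow> int \<Rightarrow> int" where
  "no_lamp n = (\<lambda>k\<in>carrier (cyc n). 0)"

definition lamp_at_0 :: "nat \<Rightarrow> int \<Rightarrow> int" where
  "lamp_at_0 n = (\<lambda>k\<in>carrier (cyc n). if k = 0 then 1 else 0)"

definition lamplighter_gens :: "nat \<Rightarrow> ((int \<Rightarrow> int) \<times> int) set" where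
  "lamplighter_gens n =
     {(no_lamp n, 1), (no_lamp n, inv\<^bsub>cyc n\<^esub> 1), (lamp_at_0 n, 0)}"

definition lamplighter_dist ::
    "nat \<Rightarrow> (int \<Rightarrow> int) \<times> int \<Rightarrow> (int \<Rightarrow> int) \<times> int \<Rightarrow> real" where
  "lamplighter_dist n = word_metric (lamplighter n) (lamplighter_gens n)"

section \<open>The space \<open>L\<^sub>1([0,1])\<close>\<close>

text \<open>
  Elements of \<open>L\<^sub>1([0,1])\<close> are given by representatives, i.e. Lebesgue integrable real
  functions on the unit interval; \<open>L1_norm (g - h)\<close> is the distance of the classes
  of \<open>g\<close> and \<open>h\<close>.
\<close>
definition L1_space :: "(real \<Rightarrow> real) set" where
  "L1_space = {g. integrable (lebesgue_on {0..1}) g}"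

definition L1_norm :: "(real \<Rightarrow> real) \<Rightarrow> real" where
  "L1_norm g = (LINT t|lebesgue_on {0..1}. \<bar>g t\<bar>)"

section \<open>Well-definedness\<close>

lemma word_value_append:
  assumes "group G" "S \<subseteq> carrier G" "is_word G S xs" "is_word G S ys"
  shows "word_value G (xs @ ys) = word_value G xs \<otimes>\<^bsub>G\<^esub> word_value G ys"
proof -
  interpret group G by fact
  have car: "S \<union> m_inv G ` S \<subseteq> carrier G" using assms(2) by auto
  have closed: "word_value G zs \<in> carrier G" if "is_word G S zs" for zs
    using that car by (induction zs) (auto simp: word_value_def is_word_def)
  show ?thesis
    using assms(3)
  proof (induction xs)
    case Nil
    then show ?case using closed[OF assms(4)] by (simp add: word_value_def)
  next
    case (Cons a xs)
    then have "a \<in> carrier G" "is_word G S xs" using car by (auto simp: is_word_def)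
    then show ?case using Cons.IH closed[OF assms(4)] closed[of xs]
      by (simp add: word_value_def m_assoc)
  qed
qed

lemma generate_imp_word:
  assumes "group G" "S \<subseteq> carrier G" "g \<in> generate G S"
  shows "\<exists>ws. is_word G S ws \<and> word_value G ws = g"
  using assms(3)
proof (induction rule: generate.induct)
  case one
  show ?case by (intro exI[of _ "[]"]) (simp add: is_word_def word_value_def)
next
  case (incl h)
  interpret group G by fact
  show ?case using incl assms(2)
    by (intro exI[of _ "[h]"]) (auto simp: is_word_def word_value_def)
next
  case (inv h)
  interpret group G by fact
  show ?case using inv assms(2)
    by (intro exI[of _ "[inv\<^bsub>G\<^esub> h]"]) (auto simp: is_word_def word_value_def)
next
  case (eng g h)
  then obtain xs ys where "is_word G S xs" "word_value G xs = g" "is_word G S ys" "word_value G ys = h"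
    by blast
  then show ?case using word_value_append[OF assms(1,2)]
    by (intro exI[of _ "xs @ ys"]) (auto simp: is_word_def)
qed

lemma carrier_lamplighter:
  "n > 0 \<Longrightarrow> carrier (lamplighter n) = ({0..<int n} \<rightarrow>\<^sub>E {0..<2}) \<times> {0..<int n}"
  by (simp add: lamplighter_def carrier_integer_mod_group)

lemma mult_lamplighter:
  assumes "n > 0" "i \<in> {0..<int n}"
  shows "(x, i) \<otimes>\<^bsub>lamplighter n\<^esub> (y, j) =
    (\<lambda>k\<in>{0..<int n}. (x k + y ((k - i) mod int n)) mod 2, (i + j) mod int n)"
proof -
  have "i \<in> carrier (cyc n)" using assms by (simp add: carrier_integer_mod_group)
  then show ?thesis using assms
    by (simp add: lamplighter_def carrier_integer_mod_group mod_add_right_eq)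
qed

lemma one_lamplighter:
  "n > 0 \<Longrightarrow> \<one>\<^bsub>lamplighter n\<^esub> = (\<lambda>k\<in>{0..<int n}. 0, 0)"
  by (simp add: lamplighter_def carrier_integer_mod_group)

lemma mod2_lamps:
  fixes x :: "int \<Rightarrow> int"
  assumes "x \<in> A \<rightarrow>\<^sub>E {0..<2}" "k \<in> A"
  shows "x k mod 2 = x k"
proof -
  have "x k \<in> {0..<2}" using assms by blast
  then show ?thesis by simp
qed

lemma group_lamplighter:
  assumes "n > 0"
  shows "group (lamplighter n)"
proof (rule groupI)
  fix u v assume "u \<in> carrier (lamplighter n)" "v \<in> carrier (lamplighter n)"
  then show "u \<otimes>\<^bsub>lamplighter n\<^esub> v \<in> carrier (lamplighter n)"
    using assms by (cases u; cases v) (auto simp: mult_lamplighter carrier_lamplighter)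
next
  show "\<one>\<^bsub>lamplighter n\<^esub> \<in> carrier (lamplighter n)"
    using assms by (auto simp: one_lamplighter carrier_lamplighter)
next
  fix u v w
  assume uvw: "u \<in> carrier (lamplighter n)" "v \<in> carrier (lamplighter n)" "w \<in> carrier (lamplighter n)"
  obtain x i y j z l where eq: "u = (x, i)" "v = (y, j)" "w = (z, l)" by (metis surj_pair)
  have [simp]: "(k - (i + j) mod int n) mod int n = ((k - i) mod int n - j) mod int n" for k
    by (simp add: mod_diff_left_eq mod_diff_right_eq algebra_simps)
  have "i \<in> {0..<int n}" "j \<in> {0..<int n}" "(i + j) mod int n \<in> {0..<int n}"
    using uvw assms by (auto simp: eq carrier_lamplighter)
  then show "u \<otimes>\<^bsub>lamplighter n\<^esub> v \<otimes>\<^bsub>lamplighter n\<^esub> w = u \<otimes>\<^bsub>lamplighter n\<^esub> (v \<otimes>\<^bsub>lamplighter n\<^esub> w)"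
    unfolding eq using assms
    by (auto simp: mult_lamplighter fun_eq_iff mod_add_left_eq mod_add_right_eq algebra_simps)
next
  fix u assume u: "u \<in> carrier (lamplighter n)"
  obtain x i where eq: "u = (x, i)" by fastforce
  have ux: "i \<in> {0..<int n}" "x \<in> {0..<int n} \<rightarrow>\<^sub>E {0..<2}"
    using u assms by (auto simp: eq carrier_lamplighter)
  then have x2: "x k mod 2 = x k" if "k \<in> {0..<int n}" for k using mod2_lamps that by blast
  show "\<one>\<^bsub>lamplighter n\<^esub> \<otimes>\<^bsub>lamplighter n\<^esub> u = u"
    using ux assms x2 by (auto simp: one_lamplighter eq mult_lamplighter fun_eq_iff PiE_def extensional_def)
  let ?v = "(\<lambda>k\<in>{0..<int n}. x ((k + i) mod int n), (- i) mod int n)"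
  have "?v \<in> carrier (lamplighter n)" using ux assms by (auto simp: carrier_lamplighter)
  moreover have "?v \<otimes>\<^bsub>lamplighter n\<^esub> u = \<one>\<^bsub>lamplighter n\<^esub>"
    using ux assms
    by (auto simp: eq mult_lamplighter one_lamplighter fun_eq_iff mod_diff_right_eq mod_add_left_eq)
  ultimately show "\<exists>v\<in>carrier (lamplighter n). v \<otimes>\<^bsub>lamplighter n\<^esub> u = \<one>\<^bsub>lamplighter n\<^esub>" by blast
qed

lemma lamplighter_gens_subset:
  "n \<ge> 2 \<Longrightarrow> lamplighter_gens n \<subseteq> carrier (lamplighter n)"
  by (auto simp: lamplighter_gens_def carrier_lamplighter no_lamp_def lamp_at_0_def
      carrier_integer_mod_group)

lemma generate_lamplighter:
  assumes "n \<ge> 2"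
  shows "generate (lamplighter n) (lamplighter_gens n) = carrier (lamplighter n)"
proof
  let ?G = "lamplighter n" and ?H = "generate (lamplighter n) (lamplighter_gens n)"
  have n: "n > 0" using assms by simp
  interpret group ?G using n by (rule group_lamplighter)
  show "?H \<subseteq> carrier ?G" using lamplighter_gens_subset[OF assms] by (rule generate_incl)
  have no: "no_lamp n = (\<lambda>k\<in>{0..<int n}. 0)" using n by (simp add: no_lamp_def carrier_integer_mod_group)
  have la: "lamp_at_0 n = (\<lambda>k\<in>{0..<int n}. if k = 0 then 1 else 0)"
    using n by (simp add: lamp_at_0_def carrier_integer_mod_group)
  have gens: "(no_lamp n, 1) \<in> ?H" "(lamp_at_0 n, 0) \<in> ?H"
    by (auto intro!: generate.incl simp: lamplighter_gens_def)
  have step: "(x, (i + 1) mod int n) \<in> ?H"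
    if "(x, i) \<in> ?H" "x \<in> {0..<int n} \<rightarrow>\<^sub>E {0..<2}" "i \<in> {0..<int n}" for x i
  proof -
    have "x k mod 2 = x k" if "k \<in> {0..<int n}" for k
      using that \<open>x \<in> {0..<int n} \<rightarrow>\<^sub>E {0..<2}\<close> mod2_lamps by blast
    then have "(x, i) \<otimes>\<^bsub>?G\<^esub> (no_lamp n, 1) = (x, (i + 1) mod int n)"
      using n that by (auto simp: mult_lamplighter no fun_eq_iff PiE_def extensional_def)
    then show ?thesis using generate.eng[OF that(1) gens(1)] by simp
  qed
  have shift: "(x, (i + int m) mod int n) \<in> ?H"
    if "(x, i) \<in> ?H" "x \<in> {0..<int n} \<rightarrow>\<^sub>E {0..<2}" "i \<in> {0..<int n}" for x i m
  proof (induction m)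
    case 0
    then show ?case using that by simp
  next
    case (Suc m)
    then show ?case using step[OF Suc that(2)] n
      by (simp add: mod_add_left_eq add.assoc) (simp add: add.commute)
  qed
  have move: "(x, j) \<in> ?H"
    if "(x, i) \<in> ?H" "x \<in> {0..<int n} \<rightarrow>\<^sub>E {0..<2}" "i \<in> {0..<int n}" "j \<in> {0..<int n}" for x i j
    using shift[OF that(1-3), of "nat ((j - i) mod int n)"] that n
    by (simp add: mod_add_right_eq)
  have all: "(\<lambda>k\<in>{0..<int n}. if k \<in> A then 1 else 0, 0) \<in> ?H"
    if "finite A" "A \<subseteq> {0..<int n}" for A
    using that
  proof (induction A rule: finite_induct)
    case empty
    then show ?case using generate.one[of ?G "lamplighter_gens n"]
      by (simp add: one_lamplighter n restrict_def)
  next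
    case (insert a A)
    let ?x = "\<lambda>A. \<lambda>k\<in>{0..<int n}. if k \<in> A then 1 else (0::int)"
    have x: "?x B \<in> {0..<int n} \<rightarrow>\<^sub>E {0..<2}" for B by auto
    have "(?x A, 0) \<in> ?H" using insert.prems by (intro insert.IH) blast
    then have "(?x A, a) \<in> ?H" using move[OF _ x, of A 0 a] insert.prems n by simp
    moreover have "(?x A, a) \<otimes>\<^bsub>?G\<^esub> (lamp_at_0 n, 0) = (?x (insert a A), a)"
    proof -
      have "(k - a) mod int n = 0 \<longleftrightarrow> k = a" if "k \<in> {0..<int n}" for k
        using that insert.prems mod_eq_dvd_iff[of k "int n" a] by (simp add: dvd_eq_mod_eq_0)
      then show ?thesis using n insert.prems insert.hyps
        by (auto simp: mult_lamplighter la fun_eq_iff)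
    qed
    ultimately have "(?x (insert a A), a) \<in> ?H" using generate.eng[OF _ gens(2)] by metis
    then show ?case using move[OF _ x, of "insert a A" a 0] insert.prems n
      by (simp add: restrict_def)
  qed
  show "carrier ?G \<subseteq> ?H"
  proof
    fix u assume u: "u \<in> carrier ?G"
    obtain x i where eq: "u = (x, i)" by fastforce
    have xi: "x \<in> {0..<int n} \<rightarrow>\<^sub>E {0..<2}" "i \<in> {0..<int n}"
      using u n by (auto simp: eq carrier_lamplighter)
    have "x k = 0 \<or> x k = 1" if "k \<in> {0..<int n}" for k
    proof -
      have "x k \<in> {0..<2}" using xi(1) that by blast
      then show ?thesis by auto
    qed
    then have "x = (\<lambda>k\<in>{0..<int n}. if k \<in> {k \<in> {0..<int n}. x k = 1} then 1 else 0)"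
      using xi(1) by (fastforce simp: fun_eq_iff PiE_def extensional_def)
    then have "(x, 0) \<in> ?H" using all[of "{k \<in> {0..<int n}. x k = 1}"]
        finite_subset[of "{k \<in> {0..<int n}. x k = 1}" "{0..<int n}"]
      by (metis (no_types, lifting) finite_atLeastLessThan_int mem_Collect_eq subsetI)
    then show "u \<in> ?H" unfolding eq using move[of x 0 i] xi n by simp
  qed
qed

end

theory Submission
  imports Defs
begin

text \<open>
  Let \<open>h = n div 2\<close> and let \<open>I\<^sub>p\<close> be the arc of length \<open>h\<close> starting at \<open>p\<close>. Each of the \<open>n\<close>
  arcs contributes the vector that is \<open>0\<close> while the lamplighter stands inside \<open>I\<^sub>p\<close> and is the
  unit vector labelled by the restriction of the lamps to \<open>I\<^sub>p\<close> while the lamplighter stands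
  outside. Together with the lamps themselves these form finitely many real
  coordinates, and their \<open>\<ell>\<^sub>1\<close>-distance is within constant factors of the word metric.

  Upper bound (\<open>coord_dist_le_lamplighter_dist\<close>). A lamp can only be switched at the
  lamplighter's position, hence when it lies in an arc, its vector there is \<open>0\<close>
  before and after; so a switch changes one lamp coordinate and no arc vector. A move
  changes only the vectors of the two arcs that have the crossed edge at one of their ends.
  Each generator thus moves the image by at most \<open>2\<close>.

  Lower bound (\<open>lamplighter_dist_le_coord_dist\<close>). Compare \<open>(x, i)\<close> with \<open>(y, j)\<close>, and let \<open>a\<close> be
  \<open>j\<close> or a position where \<open>x\<close> and \<open>y\<close> differ. If \<open>I\<^sub>p\<close> contains \<open>a\<close> but not \<open>i\<close>, then the unit
  vector of \<open>(x, i)\<close> in \<open>I\<^sub>p\<close> differs from the vector of \<open>(y, j)\<close>, wherever \<open>j\<close> lies.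
  For half arcs the number of such \<open>p\<close> is at least the cyclic distance of \<open>a\<close> and \<open>i\<close>. So,
  if \<open>T\<close> is the total contribution of the arcs, all those \<open>a\<close> are within distance \<open>T\<close> of
  \<open>i\<close>; the lamplighter can sweep \<open>T\<close> steps to the left and back, \<open>T\<close> steps to the right and
  back, and finally walk to \<open>j\<close>, which costs at most \<open>5 T\<close> moves plus one switch per differing
  lamp. Hence the distance is at most \<open>5\<close> times that of the coordinates, and the
  distortion is at most \<open>10\<close>.

  Finally, a finite-dimensional \<open>\<ell>\<^sub>1\<close> embeds isometrically up to scale into \<open>L\<^sub>1([0,1])\<close> by step
  functions (\<open>finite_l1_embeds_L1\<close>).
\<close>

section \<open>Finitely many coordinates in the unit interval\<close>

text \<open>At most one summand is nonzero, so the triangle inequality is an equality.\<close>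
lemma abs_sum_disjoint:
  fixes g :: "'a \<Rightarrow> real"
  assumes "finite K" "\<And>k l. k \<in> K \<Longrightarrow> l \<in> K \<Longrightarrow> k \<noteq> l \<Longrightarrow> g k = 0 \<or> g l = 0"
  shows "\<bar>\<Sum>k\<in>K. g k\<bar> = (\<Sum>k\<in>K. \<bar>g k\<bar>)"
proof (cases "\<exists>k\<in>K. g k \<noteq> 0")
  case True
  then obtain k where k: "k \<in> K" "g k \<noteq> 0" by blast
  then have "g l = 0" if "l \<in> K - {k}" for l using assms(2)[of k l] that by auto
  then show ?thesis using k assms(1) by (simp add: sum.remove[of K k])
qed simp

text \<open>
  Each coordinate becomes the height of a step function over its own subinterval, all
  subintervals having the same length.
\<close>
lemma finite_l1_embeds_L1:
  fixes g :: "'k \<Rightarrow> 'a \<Rightarrow> real"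
  assumes "finite K"
  shows "\<exists>f c. range f \<subseteq> L1_space \<and> c > 0 \<and>
    (\<forall>u v. L1_norm (\<lambda>t. f u t - f v t) = c * (\<Sum>k\<in>K. \<bar>g k u - g k v\<bar>))"
proof -
  \<comment> \<open>The successor keeps the scale \<open>1 / N\<close> meaningful for empty \<open>K\<close>.\<close>
  define N where "N = Suc (card K)"
  have N: "real N > 0" by (simp add: N_def)
  obtain h where h: "inj_on h K" "h ` K = {0..<card K}"
    using ex_bij_betw_finite_nat[OF assms] by (auto simp: bij_betw_def)
  define J where "J k = {real (h k) / N..<(real (h k) + 1) / N}" for k
  define f where "f u t = (\<Sum>k\<in>K. g k u * indicator (J k) t)" for u t
  have J01: "J k \<subseteq> {0..1}" if "k \<in> K" for k
  proof -
    have "h k < card K" using h(2) that by auto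
    then have "0 \<le> real (h k) / N" "(real (h k) + 1) / N \<le> 1" by (auto simp: N_def)
    then have "0 \<le> t \<and> t \<le> 1" if "t \<in> J k" for t
      using that unfolding J_def by (metis atLeastLessThan_iff less_imp_le order_trans)
    then show ?thesis by auto
  qed
  have Jdisj: "t \<notin> J k \<or> t \<notin> J l" if "k \<in> K" "l \<in> K" "k \<noteq> l" for k l t
  proof -
    have "h k \<noteq> h l" using h(1) that by (auto dest: inj_onD)
    then show ?thesis using N by (auto simp: J_def field_simps)
  qed
  have meas: "J k \<in> sets (lebesgue_on {0..1})" if "k \<in> K" for k
    using J01[OF that] by (simp add: J_def sets_restrict_space_iff)
  have mJ: "measure (lebesgue_on {0..1}) (J k) = 1 / N" if "k \<in> K" for k
    using J01[OF that] N by (simp add: measure_restrict_space J_def diff_divide_distrib[symmetric] divide_right_mono)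
  have int: "integrable (lebesgue_on {0..1}) (\<lambda>t. r * indicator (J k) t :: real)" if "k \<in> K" for k r
  proof -
    have "emeasure (lebesgue_on {0..1}) (J k) < \<infinity>"
      using J01[OF that] by (simp add: emeasure_restrict_space J_def divide_right_mono)
    then show ?thesis using meas[OF that] by (intro integrable_mult_right integrable_real_indicator)
  qed
  have LI: "(LINT t|lebesgue_on {0..1}. r * indicator (J k) t) = r * (1 / N)" if "k \<in> K" for k r
    using meas[OF that] mJ[OF that] sets.sets_into_space[OF meas[OF that]] by (simp add: Int_absorb2)
  have "L1_norm (\<lambda>t. f u t - f v t) = 1 / N * (\<Sum>k\<in>K. \<bar>g k u - g k v\<bar>)" for u v
  proof -
    have "\<bar>f u t - f v t\<bar> = (\<Sum>k\<in>K. \<bar>g k u - g k v\<bar> * indicator (J k) t)" for t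
    proof -
      have "f u t - f v t = (\<Sum>k\<in>K. (g k u - g k v) * indicator (J k) t)"
        by (simp add: f_def sum_subtractf left_diff_distrib)
      also have "\<bar>\<dots>\<bar> = (\<Sum>k\<in>K. \<bar>(g k u - g k v) * indicator (J k) t\<bar>)"
        using assms Jdisj[of _ _ t] by (intro abs_sum_disjoint) (auto simp: indicator_def)
      finally show ?thesis by (simp add: abs_mult)
    qed
    then have "L1_norm (\<lambda>t. f u t - f v t) =
        (LINT t|lebesgue_on {0..1}. (\<Sum>k\<in>K. \<bar>g k u - g k v\<bar> * indicator (J k) t))"
      by (simp add: L1_norm_def)
    also have "\<dots> = (\<Sum>k\<in>K. LINT t|lebesgue_on {0..1}. \<bar>g k u - g k v\<bar> * indicator (J k) t)"
      by (rule Bochner_Integration.integral_sum) (rule int)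
    also have "\<dots> = (\<Sum>k\<in>K. \<bar>g k u - g k v\<bar> * (1 / N))"
      by (intro sum.cong refl LI)
    finally show ?thesis by (simp add: sum_divide_distrib)
  qed
  moreover have "range f \<subseteq> L1_space"
    unfolding L1_space_def f_def by (auto intro!: Bochner_Integration.integrable_sum int)
  ultimately show ?thesis using N by (intro exI[of _ f] exI[of _ "1 / real N"]) auto
qed

section \<open>Word length\<close>

lemma word_length_le:
  "is_word G S ws \<Longrightarrow> word_value G ws = g \<Longrightarrow> word_length G S g \<le> length ws"
  unfolding word_length_def by (rule Least_le) blast

lemma word_length_attained:
  assumes "group G" "S \<subseteq> carrier G" "g \<in> generate G S"
  obtains ws where "is_word G S ws" "word_value G ws = g" "length ws = word_length G S g"
proof -
  have "\<exists>k ws. is_word G S ws \<and> word_value G ws = g \<and> length ws = k"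
    using generate_imp_word[OF assms] by blast
  from LeastI_ex[OF this] that show ?thesis unfolding word_length_def by blast
qed

lemma word_length_mult:
  assumes "group G" "S \<subseteq> carrier G" "g \<in> generate G S" "h \<in> generate G S"
  shows "word_length G S (g \<otimes>\<^bsub>G\<^esub> h) \<le> word_length G S g + word_length G S h"
proof -
  obtain xs where xs: "is_word G S xs" "word_value G xs = g" "length xs = word_length G S g"
    using word_length_attained[OF assms(1-3)] .
  obtain ys where ys: "is_word G S ys" "word_value G ys = h" "length ys = word_length G S h"
    using word_length_attained[OF assms(1,2,4)] .
  have "is_word G S (xs @ ys)" using xs ys by (auto simp: is_word_def)
  from word_length_le[OF this word_value_append[OF assms(1,2) xs(1) ys(1)]] xs ys
  show ?thesis by simp
qed

lemma word_length_one: "word_length G S \<one>\<^bsub>G\<^esub> = 0"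
  using word_length_le[of G S "[]"] by (simp add: is_word_def word_value_def)

lemma word_length_generator:
  assumes "group G" "S \<subseteq> carrier G" "s \<in> S"
  shows "word_length G S s \<le> 1"
proof -
  interpret group G by fact
  show ?thesis using word_length_le[of G S "[s]" s] assms by (auto simp: is_word_def word_value_def)
qed

text \<open>
  A map that is Lipschitz on the edges of the Cayley graph is Lipschitz: the
  triangle inequality is applied along a shortest word.
\<close>
lemma dist_le_word_length:
  fixes E :: "'a \<Rightarrow> 'a \<Rightarrow> real"
  assumes "group G" "S \<subseteq> carrier G" "u \<in> carrier G" "g \<in> generate G S"
    and refl: "\<And>u. E u u = 0"
    and tri: "\<And>u v w. E u w \<le> E u v + E v w"
    and step: "\<And>u s. u \<in> carrier G \<Longrightarrow> s \<in> S \<union> m_inv G ` S \<Longrightarrow> E u (u \<otimes>\<^bsub>G\<^esub> s) \<le> C"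
  shows "E u (u \<otimes>\<^bsub>G\<^esub> g) \<le> C * word_length G S g"
proof -
  interpret group G by fact
  have *: "word_value G ws \<in> carrier G \<and> E u (u \<otimes>\<^bsub>G\<^esub> word_value G ws) \<le> C * length ws"
    if "is_word G S ws" "u \<in> carrier G" for ws u
    using that
  proof (induction ws arbitrary: u)
    case Nil
    then show ?case using refl by (simp add: word_value_def)
  next
    case (Cons s ws)
    have s: "s \<in> S \<union> m_inv G ` S" "s \<in> carrier G" "is_word G S ws"
      using Cons.prems assms(2) by (auto simp: is_word_def)
    have IH: "word_value G ws \<in> carrier G"
      "E (u \<otimes>\<^bsub>G\<^esub> s) (u \<otimes>\<^bsub>G\<^esub> s \<otimes>\<^bsub>G\<^esub> word_value G ws) \<le> C * length ws"
      using Cons.IH[OF s(3)] s(2) Cons.prems(2) by auto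
    have val: "word_value G (s # ws) = s \<otimes>\<^bsub>G\<^esub> word_value G ws" by (simp add: word_value_def)
    show ?case
      using tri[of u "u \<otimes>\<^bsub>G\<^esub> word_value G (s # ws)" "u \<otimes>\<^bsub>G\<^esub> s"] step[OF Cons.prems(2) s(1)] IH s(2) Cons.prems(2)
      by (simp add: val m_assoc distrib_left)
  qed
  obtain ws where "is_word G S ws" "word_value G ws = g" "length ws = word_length G S g"
    using word_length_attained[OF assms(1,2,4)] .
  with *[of ws u] assms(3) show ?thesis by simp
qed

section \<open>Half arcs of the cycle\<close>

text \<open>
  The length must be about half of the cycle: for shorter arcs the number of
  arcs separating two points is bounded by that length rather than by the distance, and
  for longer arcs by the length of the complement.
\<close>
definition half_arc :: "nat \<Rightarrow> int \<Rightarrow> int set" where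
  "half_arc n p = {k \<in> {0..<int n}. (k - p) mod int n < int n div 2}"

lemma inj_on_diff_mod: "inj_on (\<lambda>t. (a - t) mod int n) {0..<int n}"
proof (rule inj_onI)
  fix s t assume "s \<in> {0..<int n}" "t \<in> {0..<int n}" "(a - s) mod int n = (a - t) mod int n"
  then have "int n dvd t - s" by (simp add: mod_eq_dvd_iff algebra_simps)
  with \<open>s \<in> _\<close> \<open>t \<in> _\<close> show "s = t" 
    by (metis mod_eq_dvd_iff mod_pos_pos_trivial atLeastLessThan_iff)
qed

text \<open>
  Sliding a half arc past \<open>a\<close>, with \<open>i\<close> left outside, can be done in as many ways as there
  are steps from \<open>a\<close> to \<open>i\<close> along the shorter side. The signed number \<open>s\<close> records that
  shorter side, as the lamplighter will have to walk along it.
\<close>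
lemma half_arcs_separating:
  assumes n: "n \<ge> 2" and a: "a \<in> {0..<int n}" and i: "i \<in> {0..<int n}"
  shows "\<exists>s. a = (i + s) mod int n \<and>
    \<bar>s\<bar> \<le> int (card {p \<in> {0..<int n}. a \<in> half_arc n p \<and> i \<notin> half_arc n p})"
proof -
  let ?P = "{p \<in> {0..<int n}. a \<in> half_arc n p \<and> i \<notin> half_arc n p}"
  define h where "h = int n div 2"
  define r where "r = (a - i) mod int n"
  have r: "0 \<le> r" "r < int n" using n by (auto simp: r_def)
  have mods: "(a - (a - t) mod int n) mod int n = t mod int n"
    "(i - (a - t) mod int n) mod int n = (t - r) mod int n" for t
    by (simp_all add: r_def mod_diff_right_eq) (simp add: algebra_simps)
  have in_P: "(a - t) mod int n \<in> ?P"
    if "t mod int n < h" "(t - r) mod int n \<ge> h" for t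
    using that n a i by (simp add: half_arc_def mods h_def)
  have ar: "a = (i + r) mod int n" using a by (simp add: r_def mod_add_right_eq)
  have count: "nat (t2 - t1) \<le> card ?P"
    if "0 \<le> t1" "t2 \<le> int n" "\<And>t. t \<in> {t1..<t2} \<Longrightarrow> (a - t) mod int n \<in> ?P" for t1 t2
  proof -
    have "inj_on (\<lambda>t. (a - t) mod int n) {t1..<t2}"
      using that by (intro inj_on_subset[OF inj_on_diff_mod]) auto
    moreover have "(\<lambda>t. (a - t) mod int n) ` {t1..<t2} \<subseteq> ?P" using that(3) by blast
    moreover have "finite ?P" by (rule finite_subset[of _ "{0..<int n}"]) auto
    ultimately have "card {t1..<t2} \<le> card ?P" by (rule card_inj_on_le)
    then show ?thesis by simp
  qed
  show ?thesis
  proof (cases "2 * r \<le> int n")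
    case True
    \<comment> \<open>Arcs that start after \<open>i\<close> and at most at \<open>a\<close>.\<close>
    have "(a - t) mod int n \<in> ?P" if t: "t \<in> {0..<r}" for t
    proof (rule in_P)
      have "r \<le> h" using True unfolding h_def by presburger
      then show "t mod int n < h" using t r by simp
      have "(t - r) mod int n = (t - r + int n) mod int n" by simp
      also have "\<dots> = t - r + int n" using t r by (intro mod_pos_pos_trivial) auto
      also have "\<dots> \<ge> h" using t True unfolding h_def by auto
      finally show "(t - r) mod int n \<ge> h" .
    qed
    then have "nat (r - 0) \<le> card ?P" using r by (intro count) auto
    then show ?thesis using ar r by (intro exI[of _ r]) auto
  next
    case False
    let ?s = "int n - r"
    \<comment> \<open>Here \<open>i\<close> lies \<open>?s\<close> steps ahead of \<open>a\<close>: arcs that end at \<open>a\<close> or later, but before \<open>i\<close>.\<close>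
    have "(a - t) mod int n \<in> ?P" if t: "t \<in> {h - ?s..<h}" for t
    proof (rule in_P)
      have t0: "0 \<le> t" "t < h" "h < int n" using t False n by (auto simp: h_def)
      then show "t mod int n < h" by simp
      have "(t - r) mod int n = (t - r + int n) mod int n" by simp
      also have "\<dots> = t - r + int n" using t t0 r False by (intro mod_pos_pos_trivial) (auto simp: h_def)
      finally show "(t - r) mod int n \<ge> h" using t by simp
    qed
    then have "nat (h - (h - ?s)) \<le> card ?P" using r False by (intro count) (auto simp: h_def)
    moreover have "a = (i + (r - int n)) mod int n" using ar by (simp add: add_diff_eq)
    ultimately show ?thesis using r by (intro exI[of _ "r - int n"]) auto
  qed
qed

text \<open>A separating arc either starts right after the edge or ends right before it.\<close>
lemma half_arcs_cutting_edge:
  assumes n: "n \<ge> 2" and i: "i \<in> {0..<int n}"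
  shows "card {p \<in> {0..<int n}. (i \<in> half_arc n p) \<noteq> ((i + 1) mod int n \<in> half_arc n p)} \<le> 2"
proof -
  define h where "h = int n div 2"
  have "p = (i + 1) mod int n \<or> p = (i + 1 - h) mod int n"
    if p: "p \<in> {0..<int n}" "(i \<in> half_arc n p) \<noteq> ((i + 1) mod int n \<in> half_arc n p)" for p
  proof -
    define m where "m = (i - p) mod int n"
    have m: "0 \<le> m" "m < int n" using n by (auto simp: m_def)
    have "((i + 1) mod int n - p) mod int n = (m + 1) mod int n"
      by (simp add: m_def mod_simps algebra_simps)
    then have cut: "(m < h) \<noteq> ((m + 1) mod int n < h)"
      using p i n by (simp add: half_arc_def m_def h_def)
    have pm: "p = (i - m) mod int n"
      using p by (simp add: m_def mod_diff_right_eq)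
    show ?thesis
    proof (cases "m = int n - 1")
      case True
      then have e: "i - m = i + 1 - int n" by simp
      have "p = (i + 1 - int n) mod int n" using pm unfolding e .
      then show ?thesis by simp
    next
      case False
      then have "m = h - 1" using cut m by auto
      then have e: "i - m = i + 1 - h" by simp
      show ?thesis using pm unfolding e by blast
    qed
  qed
  then have "{p \<in> {0..<int n}. (i \<in> half_arc n p) \<noteq> ((i + 1) mod int n \<in> half_arc n p)}
      \<subseteq> {(i + 1) mod int n, (i + 1 - h) mod int n}" by blast
  from card_mono[OF _ this] show ?thesis
    by (simp add: card_insert_if split: if_splits)
qed

section \<open>Walks of the lamplighter\<close>

abbreviation lamps :: "nat \<Rightarrow> (int \<Rightarrow> int) set" where
  "lamps n \<equiv> {0..<int n} \<rightarrow>\<^sub>E {0..<2}"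

abbreviation llen :: "nat \<Rightarrow> (int \<Rightarrow> int) \<times> int \<Rightarrow> nat" where
  "llen n \<equiv> word_length (lamplighter n) (lamplighter_gens n)"

lemma lamp_cases:
  assumes "x \<in> lamps n" "k \<in> {0..<int n}"
  shows "x k = 0 \<or> x k = 1"
proof -
  have "x k \<in> {0..<2}" using assms by blast
  then show ?thesis by auto
qed

lemma no_lamp_eq: "n \<ge> 2 \<Longrightarrow> no_lamp n = (\<lambda>k\<in>{0..<int n}. 0)"
  by (simp add: no_lamp_def carrier_integer_mod_group)

lemma lamp_at_0_eq: "n \<ge> 2 \<Longrightarrow> lamp_at_0 n = (\<lambda>k\<in>{0..<int n}. if k = 0 then 1 else 0)"
  by (simp add: lamp_at_0_def carrier_integer_mod_group)

lemma lamplighter_gens_eq: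
  "n \<ge> 2 \<Longrightarrow> lamplighter_gens n =
    {(no_lamp n, 1), (no_lamp n, (- 1) mod int n), (lamp_at_0 n, 0)}"
  by (simp add: lamplighter_gens_def inv_integer_mod_group carrier_integer_mod_group)

lemma mult_move:
  assumes "n \<ge> 2" "x \<in> lamps n" "i \<in> {0..<int n}"
  shows "(x, i) \<otimes>\<^bsub>lamplighter n\<^esub> (no_lamp n, s mod int n) = (x, (i + s) mod int n)"
  using assms mod2_lamps[OF assms(2)]
  by (auto simp: mult_lamplighter no_lamp_eq fun_eq_iff PiE_def extensional_def mod_add_right_eq)

lemma mult_switch:
  assumes "n \<ge> 2" "x \<in> lamps n" "i \<in> {0..<int n}"
  shows "(x, i) \<otimes>\<^bsub>lamplighter n\<^esub> (lamp_at_0 n, 0) = (x(i := (x i + 1) mod 2), i)"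
proof -
  have "(k - i) mod int n = 0 \<longleftrightarrow> k = i" if "k \<in> {0..<int n}" for k
    using that assms mod_eq_dvd_iff[of k "int n" i] by (simp add: dvd_eq_mod_eq_0)
  then show ?thesis using assms mod2_lamps[OF assms(2)]
    by (auto simp: mult_lamplighter lamp_at_0_eq fun_eq_iff PiE_def extensional_def)
qed

lemma lamplighter_gens_inv:
  assumes n: "n \<ge> 2" and "s \<in> lamplighter_gens n \<union> m_inv (lamplighter n) ` lamplighter_gens n"
  shows "s = (no_lamp n, 1) \<or> s = (no_lamp n, (- 1) mod int n) \<or> s = (lamp_at_0 n, 0)"
proof -
  let ?G = "lamplighter n"
  interpret group ?G using n by (intro group_lamplighter) simp
  have car: "(no_lamp n, 1) \<in> carrier ?G" "(no_lamp n, (- 1) mod int n) \<in> carrier ?G"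
    "(lamp_at_0 n, 0) \<in> carrier ?G"
    using lamplighter_gens_subset[OF n] by (auto simp: lamplighter_gens_eq[OF n])
  have no: "no_lamp n \<in> lamps n" "1 \<in> {0..<int n}" "(- 1) mod int n \<in> {0..<int n}" "lamp_at_0 n \<in> lamps n"
    using n by (auto simp: no_lamp_eq lamp_at_0_eq)
  have one: "\<one>\<^bsub>?G\<^esub> = (no_lamp n, 0)" using n by (simp add: one_lamplighter no_lamp_eq)
  have "(no_lamp n, (- 1) mod int n) \<otimes>\<^bsub>?G\<^esub> (no_lamp n, 1) = \<one>\<^bsub>?G\<^esub>"
    using mult_move[OF n no(1,3), of 1] n by (simp add: one mod_add_left_eq)
  moreover have "(no_lamp n, 1) \<otimes>\<^bsub>?G\<^esub> (no_lamp n, (- 1) mod int n) = \<one>\<^bsub>?G\<^esub>"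
    using mult_move[OF n no(1,2), of "- 1"] n by (simp add: one)
  moreover have "(lamp_at_0 n, 0) \<otimes>\<^bsub>?G\<^esub> (lamp_at_0 n, 0) = \<one>\<^bsub>?G\<^esub>"
    using mult_switch[OF n no(4), of 0] n by (auto simp: one no_lamp_eq lamp_at_0_eq fun_eq_iff)
  ultimately have "inv\<^bsub>?G\<^esub> (no_lamp n, 1) = (no_lamp n, (- 1) mod int n)"
    "inv\<^bsub>?G\<^esub> (no_lamp n, (- 1) mod int n) = (no_lamp n, 1)"
    "inv\<^bsub>?G\<^esub> (lamp_at_0 n, 0) = (lamp_at_0 n, 0)"
    using inv_equality car by blast+
  then show ?thesis using assms(2) by (auto simp: lamplighter_gens_eq[OF n])
qed

lemma llen_mult_gen:
  assumes n: "n \<ge> 2" and "u \<in> carrier (lamplighter n)" "s \<in> lamplighter_gens n"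
  shows "llen n (u \<otimes>\<^bsub>lamplighter n\<^esub> s) \<le> llen n u + 1"
proof -
  have g: "group (lamplighter n)" using n by (intro group_lamplighter) simp
  note sub = lamplighter_gens_subset[OF n]
  have "llen n (u \<otimes>\<^bsub>lamplighter n\<^esub> s) \<le> llen n u + llen n s"
    using assms sub by (intro word_length_mult[OF g]) (auto simp: generate_lamplighter)
  then show ?thesis using word_length_generator[OF g sub assms(3)] by simp
qed

lemma llen_move:
  assumes n: "n \<ge> 2" and x: "x \<in> lamps n" and i: "i \<in> {0..<int n}" and s: "s \<in> {1, - 1}"
  shows "llen n (x, (i + s * int m) mod int n) \<le> llen n (x, i) + m"
proof (induction m)
  case 0
  then show ?case using i by simp
next
  case (Suc m)
  let ?j = "(i + s * int m) mod int n"
  have j: "?j \<in> {0..<int n}" using n by simp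
  have gen: "(no_lamp n, s mod int n) \<in> lamplighter_gens n"
    using s n by (auto simp: lamplighter_gens_eq)
  have "(x, ?j) \<in> carrier (lamplighter n)" using n x j by (simp add: carrier_lamplighter)
  from llen_mult_gen[OF n this gen] mult_move[OF n x j, of s]
  have "llen n (x, (?j + s) mod int n) \<le> llen n (x, ?j) + 1" by simp
  moreover have "(?j + s) mod int n = (i + s * int (Suc m)) mod int n"
    by (simp add: mod_simps algebra_simps)
  ultimately show ?case using Suc by simp
qed

lemma llen_switch:
  assumes n: "n \<ge> 2" and x: "x \<in> lamps n" and i: "i \<in> {0..<int n}"
  shows "llen n (x, i) \<le> llen n (x(i := 0), i) + (if x i \<noteq> 0 then 1 else 0)"
proof (cases "x i = 0")
  case True
  then have "x(i := 0) = x" by auto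
  then show ?thesis by simp
next
  case False
  then have 1: "x i = 1" using lamp_cases[OF x i] by simp
  have x': "x(i := 0) \<in> lamps n" using x i by (auto simp: PiE_def extensional_def)
  have gen: "(lamp_at_0 n, 0) \<in> lamplighter_gens n" by (simp add: lamplighter_gens_def)
  have "(x(i := 0), i) \<in> carrier (lamplighter n)" using n x' i by (simp add: carrier_lamplighter)
  from llen_mult_gen[OF n this gen] mult_switch[OF n x' i] 1 False
  show ?thesis by (simp add: fun_upd_idem)
qed

definition lamps_off :: "int set \<Rightarrow> (int \<Rightarrow> int) \<Rightarrow> int \<Rightarrow> int" where
  "lamps_off A x = (\<lambda>k. if k \<in> A then 0 else x k)"

lemma lamps_off_lamps: "x \<in> lamps n \<Longrightarrow> A \<subseteq> {0..<int n} \<Longrightarrow> lamps_off A x \<in> lamps n"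
  by (auto simp: lamps_off_def PiE_def Pi_def extensional_def)

definition stretch :: "nat \<Rightarrow> int \<Rightarrow> nat \<Rightarrow> int set" where
  "stretch n s t = (\<lambda>r. (s * int r) mod int n) ` {..t}"

lemma stretch_subset: "n \<ge> 2 \<Longrightarrow> stretch n s t \<subseteq> {0..<int n}"
  by (auto simp: stretch_def)

text \<open>
  Walking along a stretch of \<open>t\<close> steps, the lamplighter sets all its lamps on the way. The
  induction removes the last position, whose lamp is set at the end of the walk; if the
  walk wraps around the cycle, the position is visited earlier too, but its
  lamp is counted only once.
\<close>
lemma llen_sweep:
  assumes n: "n \<ge> 2" and x: "x \<in> lamps n" and s: "s \<in> {1, - 1}"
  shows "llen n (x, (s * int t) mod int n) \<le>
    llen n (lamps_off (stretch n s t) x, 0) + t + card {k \<in> stretch n s t. x k \<noteq> 0}"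
  using x
proof (induction t arbitrary: x)
  case 0
  have off: "lamps_off {0} x = x(0 := 0)" by (auto simp: lamps_off_def)
  have "{k \<in> {0}. x k \<noteq> 0} = (if x 0 \<noteq> 0 then {0} else {})" by auto
  then have crd: "card {k \<in> {0}. x k \<noteq> 0} = (if x 0 \<noteq> 0 then 1 else 0)" by simp
  have st: "stretch n s 0 = {0}" "(s * int 0) mod int n = 0" by (simp_all add: stretch_def)
  have "llen n (x, 0) \<le> llen n (x(0 := 0), 0) + (if x 0 \<noteq> 0 then 1 else 0)"
    using n by (intro llen_switch 0) auto
  then show ?case unfolding st off crd by linarith
next
  case (Suc t)
  let ?i = "(s * int t) mod int n" and ?p = "(s * int (Suc t)) mod int n"
  let ?x = "x(?p := 0)"
  have p: "?p \<in> {0..<int n}" "?i \<in> {0..<int n}" using n by auto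
  have x': "?x \<in> lamps n" using Suc.prems p(1) by (auto simp: PiE_def extensional_def)
  have st: "stretch n s (Suc t) = insert ?p (stretch n s t)"
    by (simp add: stretch_def atMost_Suc)
  have off: "lamps_off (stretch n s t) ?x = lamps_off (stretch n s (Suc t)) x"
    by (auto simp: st lamps_off_def)
  have fin: "finite (stretch n s t)" by (simp add: stretch_def)
  have "{k \<in> stretch n s (Suc t). x k \<noteq> 0} =
      (if x ?p \<noteq> 0 then insert ?p {k \<in> stretch n s t. ?x k \<noteq> 0} else {k \<in> stretch n s t. ?x k \<noteq> 0})"
    unfolding st by auto
  then have crd: "card {k \<in> stretch n s (Suc t). x k \<noteq> 0} =
      card {k \<in> stretch n s t. ?x k \<noteq> 0} + (if x ?p \<noteq> 0 then 1 else 0)"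
    using fin by simp
  have "llen n (x, ?p) \<le> llen n (?x, ?p) + (if x ?p \<noteq> 0 then 1 else 0)"
    by (rule llen_switch[OF n Suc.prems p(1)])
  moreover have "llen n (?x, ?p) \<le> llen n (?x, ?i) + 1"
  proof -
    have e: "(?i + s * int 1) mod int n = ?p" by (simp add: mod_simps algebra_simps)
    show ?thesis using llen_move[OF n x' p(2) s, of 1] unfolding e .
  qed
  moreover have "llen n (?x, ?i) \<le>
      llen n (lamps_off (stretch n s t) ?x, 0) + t + card {k \<in> stretch n s t. ?x k \<noteq> 0}"
    by (rule Suc.IH[OF x'])
  ultimately show ?case unfolding crd off by linarith
qed

lemma llen_sweep_return:
  assumes n: "n \<ge> 2" and x: "x \<in> lamps n" and s: "s \<in> {1, - 1}"
  shows "llen n (x, 0) \<le>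
    llen n (lamps_off (stretch n s t) x, 0) + 2 * t + card {k \<in> stretch n s t. x k \<noteq> 0}"
proof -
  have i: "(s * int t) mod int n \<in> {0..<int n}" "- s \<in> {1, - 1}" using n s by auto
  have "llen n (x, 0) \<le> llen n (x, (s * int t) mod int n) + t"
  proof -
    have e: "((s * int t) mod int n + - s * int t) mod int n = 0" by (simp add: mod_diff_left_eq)
    show ?thesis using llen_move[OF n x i, of t] unfolding e .
  qed
  with llen_sweep[OF n x s, of t] show ?thesis by simp
qed

text \<open>
  The tour: \<open>M\<close> steps left and back, \<open>M\<close> steps right and back, then to \<open>j\<close>. The sweep to
  the left skips the lamps of the right stretch, so that no switch is counted twice.
\<close>
lemma llen_upper:
  assumes n: "n \<ge> 2" and x: "x \<in> lamps n"
    and near: "\<And>k. k \<in> {0..<int n} \<Longrightarrow> x k \<noteq> 0 \<or> k = j \<Longrightarrow> \<exists>s. k = s mod int n \<and> \<bar>s\<bar> \<le> int M"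
    and j: "j \<in> {0..<int n}"
  shows "llen n (x, j) \<le> 5 * M + card {k \<in> {0..<int n}. x k \<noteq> 0}"
proof -
  let ?R = "stretch n 1 M" and ?L = "stretch n (- 1) M"
  let ?y = "lamps_off ?R x"
  have signed: "\<exists>r \<in> {1, - 1}. \<exists>t \<le> M. k = (r * int t) mod int n"
    if k: "k \<in> {0..<int n}" "x k \<noteq> 0 \<or> k = j" for k
  proof -
    obtain s where s: "k = s mod int n" "\<bar>s\<bar> \<le> int M" using near[OF k] by blast
    show ?thesis
    proof (cases "s \<ge> 0")
      case True
      then show ?thesis using s by (intro bexI[of _ 1] exI[of _ "nat s"]) auto
    next
      case False
      then show ?thesis using s by (intro bexI[of _ "- 1"] exI[of _ "nat (- s)"]) auto
    qed
  qed
  have y: "?y \<in> lamps n" by (intro lamps_off_lamps x stretch_subset n)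
  have "lamps_off ?L ?y k = (\<lambda>k\<in>{0..<int n}. 0) k" for k
  proof (cases "k \<in> {0..<int n} \<and> x k \<noteq> 0")
    case True
    then have "k \<in> ?R \<union> ?L" using signed[of k] by (auto simp: stretch_def)
    then show ?thesis using True by (auto simp: lamps_off_def)
  next
    case False
    then show ?thesis using x stretch_subset[OF n, of 1 M] stretch_subset[OF n, of "- 1" M]
      by (auto simp: lamps_off_def PiE_def extensional_def)
  qed
  then have "(lamps_off ?L ?y, 0) = \<one>\<^bsub>lamplighter n\<^esub>"
    using n by (auto simp: one_lamplighter)
  then have "llen n (lamps_off ?L ?y, 0) = 0" by (simp add: word_length_one)
  then have "llen n (?y, 0) \<le> 2 * M + card {k \<in> ?L. ?y k \<noteq> 0}"
    using llen_sweep_return[OF n y, of "- 1" M] by simp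
  moreover have "llen n (x, 0) \<le> llen n (?y, 0) + 2 * M + card {k \<in> ?R. x k \<noteq> 0}"
    by (rule llen_sweep_return[OF n x]) simp
  moreover have "card {k \<in> ?R. x k \<noteq> 0} + card {k \<in> ?L. ?y k \<noteq> 0} \<le> card {k \<in> {0..<int n}. x k \<noteq> 0}"
  proof -
    have "finite {k \<in> ?R. x k \<noteq> 0}" "finite {k \<in> ?L. ?y k \<noteq> 0}"
      by (simp_all add: stretch_def)
    moreover have "{k \<in> ?R. x k \<noteq> 0} \<inter> {k \<in> ?L. ?y k \<noteq> 0} = {}" by (auto simp: lamps_off_def)
    ultimately have "card {k \<in> ?R. x k \<noteq> 0} + card {k \<in> ?L. ?y k \<noteq> 0} =
        card ({k \<in> ?R. x k \<noteq> 0} \<union> {k \<in> ?L. ?y k \<noteq> 0})" by (simp add: card_Un_disjoint)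
    also have "\<dots> \<le> card {k \<in> {0..<int n}. x k \<noteq> 0}"
      using stretch_subset[OF n, of 1 M] stretch_subset[OF n, of "- 1" M]
      by (intro card_mono finite_subset[of "{k \<in> {0..<int n}. x k \<noteq> 0}" "{0..<int n}"])
        (auto simp: lamps_off_def split: if_splits)
    finally show ?thesis .
  qed
  moreover have "llen n (x, j) \<le> llen n (x, 0) + M"
  proof -
    obtain r t where rt: "r \<in> {1, - 1}" "t \<le> M" "j = (r * int t) mod int n"
      using signed[OF j] by blast
    show ?thesis using llen_move[OF n x _ rt(1), of 0 t] rt n by simp
  qed
  ultimately show ?thesis by linarith
qed

text \<open>By left invariance the lamplighter may be assumed to start at \<open>0\<close> with all lamps off.\<close>
lemma lamplighter_dist_upper:
  assumes n: "n \<ge> 2" and x: "x \<in> lamps n" and y: "y \<in> lamps n"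
    and i: "i \<in> {0..<int n}" and j: "j \<in> {0..<int n}"
    and near: "\<And>a. a \<in> {0..<int n} \<Longrightarrow> x a \<noteq> y a \<or> a = j \<Longrightarrow> \<exists>s. a = (i + s) mod int n \<and> \<bar>s\<bar> \<le> int M"
  shows "lamplighter_dist n (x, i) (y, j) \<le> 5 * M + card {k \<in> {0..<int n}. x k \<noteq> y k}"
proof -
  let ?G = "lamplighter n"
  have n0: "n > 0" using n by simp
  interpret group ?G using n0 by (rule group_lamplighter)
  define z where "z = (\<lambda>k\<in>{0..<int n}. (x ((k + i) mod int n) + y ((k + i) mod int n)) mod 2)"
  define l where "l = (j - i) mod int n"
  have z: "z \<in> lamps n" and l: "l \<in> {0..<int n}" using n by (auto simp: z_def l_def)
  have car: "(x, i) \<in> carrier ?G" "(y, j) \<in> carrier ?G" "(z, l) \<in> carrier ?G"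
    using x y i j z l n0 by (auto simp: carrier_lamplighter)
  have "(x k + z ((k - i) mod int n)) mod 2 = y k" if "k \<in> {0..<int n}" for k
  proof -
    have "((k - i) mod int n + i) mod int n = k" using that by (simp add: mod_add_left_eq)
    then have "z ((k - i) mod int n) = (x k + y k) mod 2" using n by (simp add: z_def)
    then show ?thesis using lamp_cases[OF x that] lamp_cases[OF y that] by auto
  qed
  then have "(x, i) \<otimes>\<^bsub>?G\<^esub> (z, l) = (y, j)"
    using n0 i j y by (auto simp: mult_lamplighter l_def mod_add_right_eq fun_eq_iff PiE_def extensional_def)
  then have "inv\<^bsub>?G\<^esub> (x, i) \<otimes>\<^bsub>?G\<^esub> (y, j) = (z, l)"
    using car by (metis inv_solve_left)
  then have dist: "lamplighter_dist n (x, i) (y, j) = llen n (z, l)"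
    by (simp add: lamplighter_dist_def word_metric_def)
  have zne: "x ((k + i) mod int n) \<noteq> y ((k + i) mod int n)" if "k \<in> {0..<int n}" "z k \<noteq> 0" for k
    using that by (auto simp: z_def)
  have "llen n (z, l) \<le> 5 * M + card {k \<in> {0..<int n}. z k \<noteq> 0}"
  proof (rule llen_upper[OF n z _ l])
    fix k assume k: "k \<in> {0..<int n}" "z k \<noteq> 0 \<or> k = l"
    let ?a = "(k + i) mod int n"
    have "x ?a \<noteq> y ?a \<or> ?a = j" using k zne j by (auto simp: l_def mod_add_left_eq)
    then obtain s where s: "?a = (i + s) mod int n" "\<bar>s\<bar> \<le> int M" using near[of ?a] n by auto
    have "k = (?a - i) mod int n" using k by (simp add: mod_diff_left_eq)
    then have "k = s mod int n" by (simp add: s(1) mod_diff_left_eq)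
    with s(2) show "\<exists>s. k = s mod int n \<and> \<bar>s\<bar> \<le> int M" by blast
  qed
  moreover have "card {k \<in> {0..<int n}. z k \<noteq> 0} \<le> card {k \<in> {0..<int n}. x k \<noteq> y k}"
  proof (rule card_inj_on_le)
    show "inj_on (\<lambda>k. (k + i) mod int n) {k \<in> {0..<int n}. z k \<noteq> 0}"
    proof (rule inj_onI)
      fix k k' assume "k \<in> {k \<in> {0..<int n}. z k \<noteq> 0}" "k' \<in> {k \<in> {0..<int n}. z k \<noteq> 0}"
        "(k + i) mod int n = (k' + i) mod int n"
      then show "k = k'"
        by (metis (no_types, lifting) add_diff_cancel_right' atLeastLessThan_iff mem_Collect_eq
            mod_diff_left_eq mod_pos_pos_trivial)
    qed
    show "(\<lambda>k. (k + i) mod int n) ` {k \<in> {0..<int n}. z k \<noteq> 0} \<subseteq> {k \<in> {0..<int n}. x k \<noteq> y k}"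
      using zne n by auto
    show "finite {k \<in> {0..<int n}. x k \<noteq> y k}"
      by (rule finite_subset[of _ "{0..<int n}"]) auto
  qed
  ultimately show ?thesis unfolding dist by linarith
qed

section \<open>The embedding\<close>

text \<open>
  The coordinates \<open>Inr (p, z)\<close> with fixed \<open>p\<close> form the vector that is zero if the lamplighter
  is inside the arc, and the unit vector labelled by the lamps of the arc otherwise.
\<close>
fun coord :: "nat \<Rightarrow> int + int \<times> (int \<Rightarrow> int) \<Rightarrow> (int \<Rightarrow> int) \<times> int \<Rightarrow> real" where
  "coord n (Inl k) (x, i) = real_of_int (x k)"
| "coord n (Inr (p, z)) (x, i) = of_bool (i \<notin> half_arc n p \<and> restrict x (half_arc n p) = z)"

definition arc_dist :: "nat \<Rightarrow> int \<Rightarrow> (int \<Rightarrow> int) \<times> int \<Rightarrow> (int \<Rightarrow> int) \<times> int \<Rightarrow> real" where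
  "arc_dist n p u v =
    (\<Sum>z\<in>half_arc n p \<rightarrow>\<^sub>E {0..<2}. \<bar>coord n (Inr (p, z)) u - coord n (Inr (p, z)) v\<bar>)"

definition coords :: "nat \<Rightarrow> (int + int \<times> (int \<Rightarrow> int)) set" where
  "coords n = {0..<int n} <+> (SIGMA p:{0..<int n}. half_arc n p \<rightarrow>\<^sub>E {0..<2})"

definition coord_dist :: "nat \<Rightarrow> (int \<Rightarrow> int) \<times> int \<Rightarrow> (int \<Rightarrow> int) \<times> int \<Rightarrow> real" where
  "coord_dist n u v = (\<Sum>c\<in>coords n. \<bar>coord n c u - coord n c v\<bar>)"

lemma finite_half_arc_lamps: "finite (half_arc n p \<rightarrow>\<^sub>E {0..<2::int})"
  by (intro finite_PiE finite_subset[of "half_arc n p" "{0..<int n}"]) (auto simp: half_arc_def)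

lemma finite_coords: "finite (coords n)"
  by (auto simp: coords_def finite_half_arc_lamps)

lemma coord_dist_eq:
  "coord_dist n u v = (\<Sum>k\<in>{0..<int n}. \<bar>coord n (Inl k) u - coord n (Inl k) v\<bar>) +
    (\<Sum>p\<in>{0..<int n}. arc_dist n p u v)"
  by (simp add: coord_dist_def coords_def sum.Plus finite_half_arc_lamps arc_dist_def sum.Sigma)

text \<open>
  The coordinate labelled by the restriction of \<open>x\<close> already sees the difference: it is \<open>1\<close> at
  \<open>(x, i)\<close>, and at \<open>(y, j)\<close> it vanishes, either because \<open>j\<close> is inside the arc or because \<open>y\<close>
  differs from \<open>x\<close> at \<open>a\<close>.
\<close>
lemma arc_dist_ge:
  assumes "x \<in> lamps n" "a \<in> half_arc n p" "i \<notin> half_arc n p" "x a \<noteq> y a \<or> a = j"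
  shows "1 \<le> arc_dist n p (x, i) (y, j)"
proof -
  let ?z = "restrict x (half_arc n p)"
  have "?z \<in> half_arc n p \<rightarrow>\<^sub>E {0..<2}" using assms(1) by (auto simp: half_arc_def)
  moreover have "j \<in> half_arc n p \<or> restrict y (half_arc n p) \<noteq> ?z"
    using assms(2,4) by (metis restrict_apply')
  then have "\<bar>coord n (Inr (p, ?z)) (x, i) - coord n (Inr (p, ?z)) (y, j)\<bar> = 1"
    using assms(3) by auto
  ultimately show ?thesis
    using member_le_sum[of ?z "half_arc n p \<rightarrow>\<^sub>E {0..<2}"
        "\<lambda>z. \<bar>coord n (Inr (p, z)) (x, i) - coord n (Inr (p, z)) (y, j)\<bar>"] finite_half_arc_lamps
    unfolding arc_dist_def by simp
qed

lemma lamplighter_dist_le_coord_dist: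
  assumes n: "n \<ge> 2" and u: "u \<in> carrier (lamplighter n)" and v: "v \<in> carrier (lamplighter n)"
  shows "lamplighter_dist n u v \<le> 5 * coord_dist n u v"
proof -
  obtain x i y j where eq: "u = (x, i)" "v = (y, j)" by (metis surj_pair)
  have x: "x \<in> lamps n" and y: "y \<in> lamps n" and i: "i \<in> {0..<int n}" and j: "j \<in> {0..<int n}"
    using n u v by (auto simp: eq carrier_lamplighter)
  let ?A = "{k \<in> {0..<int n}. x k \<noteq> y k}"
  define T where "T = (\<Sum>p\<in>{0..<int n}. arc_dist n p u v)"
  have pos: "0 \<le> arc_dist n p u v" for p by (simp add: arc_dist_def sum_nonneg)
  then have T: "0 \<le> T" by (simp add: T_def sum_nonneg)
  have "\<exists>s. a = (i + s) mod int n \<and> \<bar>s\<bar> \<le> int (nat \<lfloor>T\<rfloor>)"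
    if a: "a \<in> {0..<int n}" "x a \<noteq> y a \<or> a = j" for a
  proof -
    let ?P = "{p \<in> {0..<int n}. a \<in> half_arc n p \<and> i \<notin> half_arc n p}"
    have "real (card ?P) = (\<Sum>p\<in>?P. 1)" by simp
    also have "\<dots> \<le> (\<Sum>p\<in>?P. arc_dist n p u v)"
      unfolding eq using a by (intro sum_mono arc_dist_ge x) auto
    also have "\<dots> \<le> T" unfolding T_def using pos by (intro sum_mono2) auto
    finally have "int (card ?P) \<le> int (nat \<lfloor>T\<rfloor>)" using T by (simp add: le_floor_iff)
    then show ?thesis using half_arcs_separating[OF n a(1) i] by (blast intro: order_trans)
  qed
  from lamplighter_dist_upper[OF n x y i j this]
  have "lamplighter_dist n u v \<le> 5 * real (nat \<lfloor>T\<rfloor>) + card ?A" by (simp add: eq)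
  also have "real (nat \<lfloor>T\<rfloor>) \<le> T" using T by simp
  also have "real (card ?A) = (\<Sum>k\<in>{0..<int n}. \<bar>coord n (Inl k) u - coord n (Inl k) v\<bar>)"
  proof -
    have "\<bar>coord n (Inl k) u - coord n (Inl k) v\<bar> = (if x k \<noteq> y k then 1 else 0)"
      if "k \<in> {0..<int n}" for k
      using lamp_cases[OF x that] lamp_cases[OF y that] by (auto simp: eq)
    then have "(\<Sum>k\<in>{0..<int n}. \<bar>coord n (Inl k) u - coord n (Inl k) v\<bar>) =
        (\<Sum>k\<in>{0..<int n}. if x k \<noteq> y k then 1 else 0)" by (rule sum.cong[OF refl])
    also have "\<dots> = real (card ?A)" by (simp add: sum.If_cases Int_def)
    finally show ?thesis by simp
  qed
  finally have "lamplighter_dist n u v \<le>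
    5 * T + (\<Sum>k\<in>{0..<int n}. \<bar>coord n (Inl k) u - coord n (Inl k) v\<bar>)" by simp
  moreover have "0 \<le> (\<Sum>k\<in>{0..<int n}. \<bar>coord n (Inl k) u - coord n (Inl k) v\<bar>)"
    by (simp add: sum_nonneg)
  ultimately show ?thesis unfolding coord_dist_eq T_def[symmetric] distrib_left by linarith
qed

lemma coord_dist_move:
  assumes n: "n \<ge> 2" and i: "i \<in> {0..<int n}"
  shows "coord_dist n (x, i) (x, (i + 1) mod int n) \<le> 2"
proof -
  let ?j = "(i + 1) mod int n"
  have arc: "arc_dist n p (x, i) (x, ?j) \<le> (if (i \<in> half_arc n p) \<noteq> (?j \<in> half_arc n p) then 1 else 0)" for p
  proof (cases "(i \<in> half_arc n p) \<noteq> (?j \<in> half_arc n p)")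
    case True
    let ?r = "restrict x (half_arc n p)"
    have "arc_dist n p (x, i) (x, ?j) = (\<Sum>z\<in>half_arc n p \<rightarrow>\<^sub>E {0..<2}. if ?r = z then 1 else 0)"
      unfolding arc_dist_def using True by (intro sum.cong) auto
    also have "\<dots> \<le> 1" by (simp add: finite_half_arc_lamps)
    finally show ?thesis using True by simp
  qed (simp add: arc_dist_def)
  have "coord_dist n (x, i) (x, ?j) = (\<Sum>p\<in>{0..<int n}. arc_dist n p (x, i) (x, ?j))"
    by (simp add: coord_dist_eq)
  also have "\<dots> \<le>
      (\<Sum>p\<in>{0..<int n}. if (i \<in> half_arc n p) \<noteq> (?j \<in> half_arc n p) then 1 else 0)"
    by (intro sum_mono arc)
  also have "\<dots> = real (card {p \<in> {0..<int n}. (i \<in> half_arc n p) \<noteq> (?j \<in> half_arc n p)})"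
    by (simp add: sum.If_cases Int_def)
  finally show ?thesis using half_arcs_cutting_edge[OF n i] by linarith
qed

text \<open>
  Arcs through the lamplighter's position have zero vectors, and the other arcs do not see
  the switched lamp.
\<close>
lemma coord_dist_switch:
  assumes x: "x \<in> lamps n" and i: "i \<in> {0..<int n}"
  shows "coord_dist n (x, i) (x(i := (x i + 1) mod 2), i) \<le> 1"
proof -
  let ?y = "x(i := (x i + 1) mod 2)"
  have "arc_dist n p (x, i) (?y, i) = 0" for p
  proof (cases "i \<in> half_arc n p")
    case False
    then have "restrict ?y (half_arc n p) = restrict x (half_arc n p)" by (auto simp: restrict_def)
    then show ?thesis by (simp add: arc_dist_def)
  qed (simp add: arc_dist_def)
  moreover have "(\<Sum>k\<in>{0..<int n}. \<bar>coord n (Inl k) (x, i) - coord n (Inl k) (?y, i)\<bar>) =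
      (\<Sum>k\<in>{0..<int n}. if i = k then 1 else 0)"
    using lamp_cases[OF x i] by (intro sum.cong) auto
  ultimately show ?thesis using i by (simp add: coord_dist_eq)
qed

lemma coord_dist_generator:
  assumes n: "n \<ge> 2" and u: "u \<in> carrier (lamplighter n)"
    and s: "s \<in> lamplighter_gens n \<union> m_inv (lamplighter n) ` lamplighter_gens n"
  shows "coord_dist n u (u \<otimes>\<^bsub>lamplighter n\<^esub> s) \<le> 2"
proof -
  obtain x i where eq: "u = (x, i)" by fastforce
  have x: "x \<in> lamps n" and i: "i \<in> {0..<int n}"
    using n u by (auto simp: eq carrier_lamplighter)
  from lamplighter_gens_inv[OF n s] show ?thesis
  proof (elim disjE)
    assume "s = (no_lamp n, 1)"
    then show ?thesis
      using mult_move[OF n x i, of 1] coord_dist_move[OF n i, of x] n by (simp add: eq)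
  next
    assume s': "s = (no_lamp n, (- 1) mod int n)"
    let ?j = "(i + - 1) mod int n"
    \<comment> \<open>A backward move is a forward move read in reverse.\<close>
    have "(?j + 1) mod int n = (i + - 1 + 1) mod int n" by (rule mod_add_left_eq)
    then have "(?j + 1) mod int n = i" using i by simp
    then have "coord_dist n (x, ?j) (x, i) \<le> 2"
      using coord_dist_move[OF n, of ?j x] n by simp
    moreover have "u \<otimes>\<^bsub>lamplighter n\<^esub> s = (x, ?j)"
      unfolding eq s' by (rule mult_move[OF n x i])
    ultimately show ?thesis by (simp add: eq coord_dist_def abs_minus_commute)
  next
    assume "s = (lamp_at_0 n, 0)"
    then show ?thesis using mult_switch[OF n x i] coord_dist_switch[OF x i] by (simp add: eq)
  qed
qed

lemma coord_dist_le_lamplighter_dist: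
  assumes n: "n \<ge> 2" and u: "u \<in> carrier (lamplighter n)" and v: "v \<in> carrier (lamplighter n)"
  shows "coord_dist n u v \<le> 2 * lamplighter_dist n u v"
proof -
  let ?G = "lamplighter n"
  interpret group ?G using n by (intro group_lamplighter) simp
  let ?g = "inv\<^bsub>?G\<^esub> u \<otimes>\<^bsub>?G\<^esub> v"
  have "coord_dist n u (u \<otimes>\<^bsub>?G\<^esub> ?g) \<le> 2 * real (llen n ?g)"
  proof (rule dist_le_word_length[OF is_group lamplighter_gens_subset[OF n] u])
    show "?g \<in> generate ?G (lamplighter_gens n)" using u v by (simp add: generate_lamplighter[OF n])
    show "coord_dist n w w'' \<le> coord_dist n w w' + coord_dist n w' w''" for w w' w''
      unfolding coord_dist_def sum.distrib[symmetric] by (intro sum_mono) linarith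
  qed (use coord_dist_generator[OF n] in \<open>auto simp: coord_dist_def\<close>)
  moreover have "u \<otimes>\<^bsub>?G\<^esub> ?g = v" using u v by (simp add: m_assoc[symmetric])
  ultimately show ?thesis by (simp add: lamplighter_dist_def word_metric_def)
qed

theorem mainTheorem9:
  shows "\<exists>D::real. D \<ge> 1 \<and>
    (\<forall>n::nat. n \<ge> 2 \<longrightarrow>
      (\<exists>(f :: (int \<Rightarrow> int) \<times> int \<Rightarrow> (real \<Rightarrow> real)) (c::real).
        f \<in> carrier (lamplighter n) \<rightarrow> L1_space \<and> c > 0 \<and>
        (\<forall>u \<in> carrier (lamplighter n). \<forall>v \<in> carrier (lamplighter n).
          c * lamplighter_dist n u v \<le> L1_norm (\<lambda>t. f u t - f v t) \<and>
          L1_norm (\<lambda>t. f u t - f v t) \<le> D * c * lamplighter_dist n u v)))"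
proof (intro exI[of _ "10::real"] conjI allI impI)
  fix n :: nat
  assume n: "n \<ge> 2"
  have "\<exists>f b. range f \<subseteq> L1_space \<and> b > 0 \<and>
      (\<forall>u v. L1_norm (\<lambda>t. f u t - f v t) = b * coord_dist n u v)"
    unfolding coord_dist_def by (rule finite_l1_embeds_L1[OF finite_coords])
  then obtain f b where fb: "range f \<subseteq> L1_space \<and> b > 0 \<and>
      (\<forall>u v. L1_norm (\<lambda>t. f u t - f v t) = b * coord_dist n u v)"
    by (elim exE)
  then have f: "range f \<subseteq> L1_space" and b: "b > 0" by simp_all
  have norm: "L1_norm (\<lambda>t. f u t - f v t) = b * coord_dist n u v" for u v
    using fb by (elim conjE allE)
  have bounds: "b / 5 * lamplighter_dist n u v \<le> L1_norm (\<lambda>t. f u t - f v t)"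
    "L1_norm (\<lambda>t. f u t - f v t) \<le> 10 * (b / 5) * lamplighter_dist n u v"
    if "u \<in> carrier (lamplighter n)" "v \<in> carrier (lamplighter n)" for u v
    unfolding norm
    using mult_left_mono[OF lamplighter_dist_le_coord_dist[OF n that], of b]
      mult_left_mono[OF coord_dist_le_lamplighter_dist[OF n that], of b] b by simp_all
  have "f \<in> carrier (lamplighter n) \<rightarrow> L1_space" "b / 5 > 0" using f b by auto
  then show "\<exists>(f :: (int \<Rightarrow> int) \<times> int \<Rightarrow> (real \<Rightarrow> real)) (c::real).
      f \<in> carrier (lamplighter n) \<rightarrow> L1_space \<and> c > 0 \<and>
      (\<forall>u \<in> carrier (lamplighter n). \<forall>v \<in> carrier (lamplighter n).
        c * lamplighter_dist n u v \<le> L1_norm (\<lambda>t. f u t - f v t) \<and>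
        L1_norm (\<lambda>t. f u t - f v t) \<le> 10 * c * lamplighter_dist n u v)"
    by (intro exI[of _ f] exI[of _ "b / 5"] conjI ballI bounds)
qed simp

end
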